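(* Let $(M^n,P)$ be a regular Poisson manifold with a pseudo-Riemannian metric $g$ whose restriction to each symplectic leaf is non-degenerate, and let $\nabla$ be the Levi-Civita connection of $g$. If $\nabla_{\alpha^\sharp}:TM\to TM$ preserves the tangent sub-bundle $T(\mathcal S)$ to the symplectic leaves for every $\alpha\in C(M)$ (i.e. $\nabla_{\alpha^\sharp}X$ is a section of $T(\mathcal S)$ for every section $X$ of $T(\mathcal S)$ and every $\alpha\in C(M)$), then $\mathcal N$ is integrable.
   Context: Regular Poisson manifold: an $n$-dimensional manifold $M$ with a Poisson bivector $P=(P^{\tau\sigma})$ of constant rank $k$, $2\le k<n$. $P$ is viewed as a bundle map $T^*M\to TM$, $(P\alpha)^\tau=P^{\tau\sigma}\alpha_\sigma$. Its image is the integrable distribution $T(\mathcal S)$ of tangent spaces to the symplectic leaves; its kernel is the sub-bundle $C(M)\subset T^*M$ of Casimir covectors. $\mathcal N=T(\mathcal S)^\perp$ is the $g$-orthogonal complement of $T(\mathcal S)$ in $TM$. $\sharp:T^*M\to TM$ is the index raising isomorphism of $g$. A distribution is integrable iff it is involutive (Frobenius). *)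

theory Defs
  imports "HOL-Analysis.Analysis"
begin

section \<open>Smooth functions on open subsets of Euclidean space\<close>

text \<open>Only meaningful for open \<open>S\<close>: derivatives are two-sided.\<close>

primrec Ck_on :: "nat \<Rightarrow> ('a::euclidean_space \<Rightarrow> 'b::real_normed_vector) \<Rightarrow> 'a set \<Rightarrow> bool" where
  "Ck_on 0 f S \<longleftrightarrow> continuous_on S f"
| "Ck_on (Suc k) f S \<longleftrightarrow>
     (\<forall>x\<in>S. f differentiable (at x)) \<and> (\<forall>v. Ck_on k (\<lambda>x. frechet_derivative f (at x) v) S)"

definition smooth_on :: "'a::euclidean_space set \<Rightarrow> ('a \<Rightarrow> 'b::real_normed_vector) \<Rightarrow> bool" where
  "smooth_on S f \<longleftrightarrow> (\<forall>k. Ck_on k f S)"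

section \<open>Smooth manifolds\<close>

text \<open>The manifold is the whole type \<open>'m\<close>; the smooth structure is given by an atlas.
  A chart is its domain together with its coordinate map, whose values outside of the
  domain are irrelevant.\<close>

type_synonym ('m, 'n) chart = "'m set \<times> ('m \<Rightarrow> real ^ 'n)"

abbreviation cdom :: "('m, 'n) chart \<Rightarrow> 'm set" where "cdom c \<equiv> fst c"
abbreviation cmap :: "('m, 'n) chart \<Rightarrow> 'm \<Rightarrow> real ^ 'n" where "cmap c \<equiv> snd c"
abbreviation cinv :: "('m, 'n) chart \<Rightarrow> real ^ 'n \<Rightarrow> 'm" where
  "cinv c \<equiv> inv_into (cdom c) (cmap c)"

definition is_chart :: "('m::topological_space, 'n::finite) chart \<Rightarrow> bool" where
  "is_chart c \<longleftrightarrow> open (cdom c) \<and> open (cmap c ` cdom c) \<and>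
     homeomorphism (cdom c) (cmap c ` cdom c) (cmap c) (cinv c)"

definition smooth_atlas ::
  "('m::{t2_space, second_countable_topology}, 'n::finite) chart set \<Rightarrow> bool" where
  "smooth_atlas A \<longleftrightarrow> (\<forall>c\<in>A. is_chart c) \<and> (\<Union>c\<in>A. cdom c) = UNIV \<and>
     (\<forall>c\<in>A. \<forall>d\<in>A. smooth_on (cmap c ` (cdom c \<inter> cdom d)) (cmap d \<circ> cinv c))"

text \<open>Jacobian matrix of the coordinate change from \<open>c\<close> to \<open>d\<close> at the point \<open>p\<close>.\<close>

definition jac :: "('m, 'n::finite) chart \<Rightarrow> ('m, 'n) chart \<Rightarrow> 'm \<Rightarrow> real ^ 'n ^ 'n" where
  "jac c d p = jacobian (cmap d \<circ> cinv c) (at (cmap c p))"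

text \<open>A geometric object over \<open>p\<close> is the family of its component arrays with respect to the
  charts around \<open>p\<close>, subject to the transformation law. For vectors and covectors, the entries
  at charts not around \<open>p\<close> are required to be \<open>0\<close>, so that equality of families is
  equality of (co)vectors.\<close>

definition tangent_space :: "('m, 'n::finite) chart set \<Rightarrow> 'm \<Rightarrow> (('m, 'n) chart \<Rightarrow> real ^ 'n) set"
  where
  "tangent_space A p = {v.
     (\<forall>c\<in>A. \<forall>d\<in>A. p \<in> cdom c \<inter> cdom d \<longrightarrow> v d = jac c d p *v v c) \<and>
     (\<forall>c. \<not> (c \<in> A \<and> p \<in> cdom c) \<longrightarrow> v c = 0)}"

definition cotangent_space :: "('m, 'n::finite) chart set \<Rightarrow> 'm \<Rightarrow> (('m, 'n) chart \<Rightarrow> real ^ 'n) set"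
  where
  "cotangent_space A p = {\<alpha>.
     (\<forall>c\<in>A. \<forall>d\<in>A. p \<in> cdom c \<inter> cdom d \<longrightarrow> \<alpha> c = transpose (jac c d p) *v \<alpha> d) \<and>
     (\<forall>c. \<not> (c \<in> A \<and> p \<in> cdom c) \<longrightarrow> \<alpha> c = 0)}"

definition chart_at :: "('m, 'n) chart set \<Rightarrow> 'm \<Rightarrow> ('m, 'n) chart" where
  "chart_at A p = (SOME c. c \<in> A \<and> p \<in> cdom c)"

text \<open>Natural pairing of a covector and a vector at \<open>p\<close>; independent of the chosen chart.\<close>

definition pairing :: "('m, 'n::finite) chart set \<Rightarrow> 'm \<Rightarrow>
    (('m, 'n) chart \<Rightarrow> real ^ 'n) \<Rightarrow> (('m, 'n) chart \<Rightarrow> real ^ 'n) \<Rightarrow> real" where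
  "pairing A p \<alpha> v = \<alpha> (chart_at A p) \<bullet> v (chart_at A p)"

text \<open>Smoothness over the open set \<open>U\<close> of a field of component arrays, chart by chart.\<close>

definition smooth_components :: "('m, 'n::finite) chart set \<Rightarrow> 'm set \<Rightarrow>
    ('m \<Rightarrow> ('m, 'n) chart \<Rightarrow> 'b::real_normed_vector) \<Rightarrow> bool" where
  "smooth_components A U T \<longleftrightarrow>
     (\<forall>c\<in>A. smooth_on (cmap c ` (cdom c \<inter> U)) (\<lambda>x. T (cinv c x) c))"

definition smooth_function :: "('m, 'n::finite) chart set \<Rightarrow> ('m \<Rightarrow> real) \<Rightarrow> bool" where
  "smooth_function A f \<longleftrightarrow> smooth_components A UNIV (\<lambda>p c. f p)"

definition vector_field :: "('m, 'n::finite) chart set \<Rightarrow> 'm set \<Rightarrow>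
    ('m \<Rightarrow> ('m, 'n) chart \<Rightarrow> real ^ 'n) \<Rightarrow> bool" where
  "vector_field A U X \<longleftrightarrow> (\<forall>p\<in>U. X p \<in> tangent_space A p) \<and> smooth_components A U X"

definition one_form :: "('m, 'n::finite) chart set \<Rightarrow> ('m \<Rightarrow> ('m, 'n) chart \<Rightarrow> real ^ 'n) \<Rightarrow> bool"
  where
  "one_form A \<alpha> \<longleftrightarrow> (\<forall>p. \<alpha> p \<in> cotangent_space A p) \<and> smooth_components A UNIV \<alpha>"

definition differential :: "('m, 'n::finite) chart set \<Rightarrow> ('m \<Rightarrow> real) \<Rightarrow>
    'm \<Rightarrow> ('m, 'n) chart \<Rightarrow> real ^ 'n" where
  "differential A f p c = (if c \<in> A \<and> p \<in> cdom c
     then \<chi> i. frechet_derivative (f \<circ> cinv c) (at (cmap c p)) (axis i 1) else 0)"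

definition vf_apply :: "('m, 'n::finite) chart set \<Rightarrow> ('m \<Rightarrow> ('m, 'n) chart \<Rightarrow> real ^ 'n) \<Rightarrow>
    ('m \<Rightarrow> real) \<Rightarrow> 'm \<Rightarrow> real" where
  "vf_apply A X f p = pairing A p (differential A f p) (X p)"

text \<open>In coordinates, \<open>[X,Y]\<^sup>i = X\<^sup>j \<partial>\<^sub>j Y\<^sup>i - Y\<^sup>j \<partial>\<^sub>j X\<^sup>i\<close>.\<close>

definition lie_bracket :: "('m, 'n::finite) chart set \<Rightarrow> ('m \<Rightarrow> ('m, 'n) chart \<Rightarrow> real ^ 'n) \<Rightarrow>
    ('m \<Rightarrow> ('m, 'n) chart \<Rightarrow> real ^ 'n) \<Rightarrow> 'm \<Rightarrow> ('m, 'n) chart \<Rightarrow> real ^ 'n" where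
  "lie_bracket A X Y p c = (if c \<in> A \<and> p \<in> cdom c
     then frechet_derivative (\<lambda>x. Y (cinv c x) c) (at (cmap c p)) (X p c) -
          frechet_derivative (\<lambda>x. X (cinv c x) c) (at (cmap c p)) (Y p c)
     else 0)"

text \<open>A distribution is given by its fibres \<open>D p\<close>. Integrability is meant in the sense of
  Frobenius: the bracket of any two local sections is again a section.\<close>

definition section_of :: "('m, 'n::finite) chart set \<Rightarrow> 'm set \<Rightarrow>
    ('m \<Rightarrow> (('m, 'n) chart \<Rightarrow> real ^ 'n) set) \<Rightarrow> ('m \<Rightarrow> ('m, 'n) chart \<Rightarrow> real ^ 'n) \<Rightarrow> bool" where
  "section_of A U D X \<longleftrightarrow> vector_field A U X \<and> (\<forall>p\<in>U. X p \<in> D p)"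

definition integrable_distribution :: "('m::topological_space, 'n::finite) chart set \<Rightarrow>
    ('m \<Rightarrow> (('m, 'n) chart \<Rightarrow> real ^ 'n) set) \<Rightarrow> bool" where
  "integrable_distribution A D \<longleftrightarrow>
     (\<forall>U X Y. open U \<longrightarrow> section_of A U D X \<longrightarrow> section_of A U D Y \<longrightarrow>
        (\<forall>p\<in>U. lie_bracket A X Y p \<in> D p))"

section \<open>Regular Poisson structures\<close>

definition bivector_field :: "('m, 'n::finite) chart set \<Rightarrow>
    ('m \<Rightarrow> ('m, 'n) chart \<Rightarrow> real ^ 'n ^ 'n) \<Rightarrow> bool" where
  "bivector_field A P \<longleftrightarrow> smooth_components A UNIV P \<and>
     (\<forall>p. \<forall>c\<in>A. p \<in> cdom c \<longrightarrow> transpose (P p c) = - P p c) \<and>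
     (\<forall>p. \<forall>c\<in>A. \<forall>d\<in>A. p \<in> cdom c \<inter> cdom d \<longrightarrow>
        P p d = jac c d p ** P p c ** transpose (jac c d p))"

text \<open>\<open>(P \<alpha>)\<^sup>\<tau> = P\<^sup>\<tau>\<^sup>\<sigma> \<alpha>\<^sub>\<sigma>\<close>, at a single point.\<close>

definition anchor :: "(('m, 'n::finite) chart \<Rightarrow> real ^ 'n ^ 'n) \<Rightarrow>
    (('m, 'n) chart \<Rightarrow> real ^ 'n) \<Rightarrow> ('m, 'n) chart \<Rightarrow> real ^ 'n" where
  "anchor Pp \<alpha> = (\<lambda>c. Pp c *v \<alpha> c)"

definition poisson_bracket :: "('m, 'n::finite) chart set \<Rightarrow>
    ('m \<Rightarrow> ('m, 'n) chart \<Rightarrow> real ^ 'n ^ 'n) \<Rightarrow> ('m \<Rightarrow> real) \<Rightarrow> ('m \<Rightarrow> real) \<Rightarrow> 'm \<Rightarrow> real" where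
  "poisson_bracket A P f h p =
     pairing A p (differential A f p) (anchor (P p) (differential A h p))"

definition poisson_bivector :: "('m, 'n::finite) chart set \<Rightarrow>
    ('m \<Rightarrow> ('m, 'n) chart \<Rightarrow> real ^ 'n ^ 'n) \<Rightarrow> bool" where
  "poisson_bivector A P \<longleftrightarrow> bivector_field A P \<and>
     (\<forall>f h l. smooth_function A f \<longrightarrow> smooth_function A h \<longrightarrow> smooth_function A l \<longrightarrow>
        (\<forall>p. poisson_bracket A P f (poisson_bracket A P h l) p +
             poisson_bracket A P h (poisson_bracket A P l f) p +
             poisson_bracket A P l (poisson_bracket A P f h) p = 0))"

definition regular_poisson_manifold :: "('m::{t2_space, second_countable_topology}, 'n::finite) chart set \<Rightarrow>
    ('m \<Rightarrow> ('m, 'n) chart \<Rightarrow> real ^ 'n ^ 'n) \<Rightarrow> nat \<Rightarrow> bool" where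
  "regular_poisson_manifold A P k \<longleftrightarrow> smooth_atlas A \<and> poisson_bivector A P \<and>
     (\<forall>p. \<forall>c\<in>A. p \<in> cdom c \<longrightarrow> rank (P p c) = k) \<and> 2 \<le> k \<and> k < CARD('n)"

text \<open>The tangent space at \<open>p\<close> of the symplectic leaf through \<open>p\<close> is the image of \<open>P\<close> at \<open>p\<close>.\<close>

definition leaf_tangent :: "('m, 'n::finite) chart set \<Rightarrow>
    ('m \<Rightarrow> ('m, 'n) chart \<Rightarrow> real ^ 'n ^ 'n) \<Rightarrow> 'm \<Rightarrow> (('m, 'n) chart \<Rightarrow> real ^ 'n) set" where
  "leaf_tangent A P p = anchor (P p) ` cotangent_space A p"

definition casimir :: "('m, 'n::finite) chart set \<Rightarrow>
    ('m \<Rightarrow> ('m, 'n) chart \<Rightarrow> real ^ 'n ^ 'n) \<Rightarrow> 'm \<Rightarrow> (('m, 'n) chart \<Rightarrow> real ^ 'n) set" where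
  "casimir A P p = {\<alpha> \<in> cotangent_space A p. anchor (P p) \<alpha> = (\<lambda>c. 0)}"

section \<open>Pseudo-Riemannian metrics and the Levi-Civita connection\<close>

text \<open>No constancy of the signature is imposed; it is automatic on connected components.\<close>

definition pseudo_riemannian_metric :: "('m, 'n::finite) chart set \<Rightarrow>
    ('m \<Rightarrow> ('m, 'n) chart \<Rightarrow> real ^ 'n ^ 'n) \<Rightarrow> bool" where
  "pseudo_riemannian_metric A g \<longleftrightarrow> smooth_components A UNIV g \<and>
     (\<forall>p. \<forall>c\<in>A. p \<in> cdom c \<longrightarrow> transpose (g p c) = g p c \<and> invertible (g p c)) \<and>
     (\<forall>p. \<forall>c\<in>A. \<forall>d\<in>A. p \<in> cdom c \<inter> cdom d \<longrightarrow>
        g p c = transpose (jac c d p) ** g p d ** jac c d p)"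

definition metric_at :: "('m, 'n::finite) chart set \<Rightarrow> ('m \<Rightarrow> ('m, 'n) chart \<Rightarrow> real ^ 'n ^ 'n) \<Rightarrow>
    'm \<Rightarrow> (('m, 'n) chart \<Rightarrow> real ^ 'n) \<Rightarrow> (('m, 'n) chart \<Rightarrow> real ^ 'n) \<Rightarrow> real" where
  "metric_at A g p v w = v (chart_at A p) \<bullet> (g p (chart_at A p) *v w (chart_at A p))"

definition sharp :: "('m \<Rightarrow> ('m, 'n::finite) chart \<Rightarrow> real ^ 'n ^ 'n) \<Rightarrow>
    ('m \<Rightarrow> ('m, 'n) chart \<Rightarrow> real ^ 'n) \<Rightarrow> 'm \<Rightarrow> ('m, 'n) chart \<Rightarrow> real ^ 'n" where
  "sharp g \<alpha> = (\<lambda>p c. matrix_inv (g p c) *v \<alpha> p c)"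

definition nondegenerate_on :: "('m, 'n::finite) chart set \<Rightarrow>
    ('m \<Rightarrow> ('m, 'n) chart \<Rightarrow> real ^ 'n ^ 'n) \<Rightarrow>
    ('m \<Rightarrow> (('m, 'n) chart \<Rightarrow> real ^ 'n) set) \<Rightarrow> bool" where
  "nondegenerate_on A g D \<longleftrightarrow>
     (\<forall>p. \<forall>v\<in>D p. (\<forall>w\<in>D p. metric_at A g p v w = 0) \<longrightarrow> v = (\<lambda>c. 0))"

definition orthogonal_distribution :: "('m, 'n::finite) chart set \<Rightarrow>
    ('m \<Rightarrow> ('m, 'n) chart \<Rightarrow> real ^ 'n ^ 'n) \<Rightarrow>
    ('m \<Rightarrow> (('m, 'n) chart \<Rightarrow> real ^ 'n) set) \<Rightarrow>
    'm \<Rightarrow> (('m, 'n) chart \<Rightarrow> real ^ 'n) set" where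
  "orthogonal_distribution A g D p =
     {v \<in> tangent_space A p. \<forall>w\<in>D p. metric_at A g p v w = 0}"

text \<open>\<open>nabla X Y\<close> stands for the covariant derivative of \<open>Y\<close> along \<open>X\<close>;
  its values are only relevant on global smooth vector fields.\<close>

definition affine_connection :: "('m, 'n::finite) chart set \<Rightarrow>
    (('m \<Rightarrow> ('m, 'n) chart \<Rightarrow> real ^ 'n) \<Rightarrow> ('m \<Rightarrow> ('m, 'n) chart \<Rightarrow> real ^ 'n) \<Rightarrow>
      'm \<Rightarrow> ('m, 'n) chart \<Rightarrow> real ^ 'n) \<Rightarrow> bool" where
  "affine_connection A nabla \<longleftrightarrow>
     (\<forall>X Y. vector_field A UNIV X \<longrightarrow> vector_field A UNIV Y \<longrightarrow> vector_field A UNIV (nabla X Y)) \<and>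
     (\<forall>X X' Y. vector_field A UNIV X \<longrightarrow> vector_field A UNIV X' \<longrightarrow> vector_field A UNIV Y \<longrightarrow>
        nabla (\<lambda>p c. X p c + X' p c) Y = (\<lambda>p c. nabla X Y p c + nabla X' Y p c)) \<and>
     (\<forall>f X Y. smooth_function A f \<longrightarrow> vector_field A UNIV X \<longrightarrow> vector_field A UNIV Y \<longrightarrow>
        nabla (\<lambda>p c. f p *\<^sub>R X p c) Y = (\<lambda>p c. f p *\<^sub>R nabla X Y p c)) \<and>
     (\<forall>X Y Y'. vector_field A UNIV X \<longrightarrow> vector_field A UNIV Y \<longrightarrow> vector_field A UNIV Y' \<longrightarrow>
        nabla X (\<lambda>p c. Y p c + Y' p c) = (\<lambda>p c. nabla X Y p c + nabla X Y' p c)) \<and>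
     (\<forall>f X Y. smooth_function A f \<longrightarrow> vector_field A UNIV X \<longrightarrow> vector_field A UNIV Y \<longrightarrow>
        nabla X (\<lambda>p c. f p *\<^sub>R Y p c) =
          (\<lambda>p c. vf_apply A X f p *\<^sub>R Y p c + f p *\<^sub>R nabla X Y p c))"

definition levi_civita_connection :: "('m, 'n::finite) chart set \<Rightarrow>
    ('m \<Rightarrow> ('m, 'n) chart \<Rightarrow> real ^ 'n ^ 'n) \<Rightarrow>
    (('m \<Rightarrow> ('m, 'n) chart \<Rightarrow> real ^ 'n) \<Rightarrow> ('m \<Rightarrow> ('m, 'n) chart \<Rightarrow> real ^ 'n) \<Rightarrow>
      'm \<Rightarrow> ('m, 'n) chart \<Rightarrow> real ^ 'n) \<Rightarrow> bool" where
  "levi_civita_connection A g nabla \<longleftrightarrow> affine_connection A nabla \<and>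
     (\<forall>X Y. vector_field A UNIV X \<longrightarrow> vector_field A UNIV Y \<longrightarrow>
        (\<forall>p c. nabla X Y p c - nabla Y X p c = lie_bracket A X Y p c)) \<and>
     (\<forall>X Y Z. vector_field A UNIV X \<longrightarrow> vector_field A UNIV Y \<longrightarrow> vector_field A UNIV Z \<longrightarrow>
        (\<forall>p. vf_apply A X (\<lambda>q. metric_at A g q (Y q) (Z q)) p =
             metric_at A g p (nabla X Y p) (Z p) + metric_at A g p (Y p) (nabla X Z p)))"

end

theory Submission
  imports Defs
begin

text \<open>Since \<open>P\<close> is skew, the metric dual of a section \<open>X\<close> of \<open>\<N>\<close> is a Casimir form, so that
  \<open>\<nabla>\<^sub>X\<close> preserves \<open>T(\<S>)\<close>. Differentiating \<open>g(Y, Z) = 0\<close> along \<open>X\<close>, for sections \<open>Y\<close> of \<open>\<N>\<close> and \<open>Z\<close> of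
  \<open>T(\<S>)\<close>, shows that \<open>\<nabla>\<^sub>X Y\<close> is a section of \<open>\<N>\<close>, hence so is \<open>[X, Y] = \<nabla>\<^sub>X Y - \<nabla>\<^sub>Y X\<close>.
  The connection acts on global fields only: local sections of \<open>\<N>\<close> are multiplied by a bump function
  that has value \<open>1\<close> and vanishing differential at the given point, and a vector of \<open>T(\<S>)\<close> is
  extended to a Hamiltonian field \<open>P dh\<close>.\<close>

section \<open>Calculus of functions of class C-k\<close>

lemma Ck_on_subset: "Ck_on k f S \<Longrightarrow> T \<subseteq> S \<Longrightarrow> Ck_on k f T"
  by (induction k arbitrary: f) (auto intro: continuous_on_subset)

text \<open>On an open set a derivative sees only nearby values, so equality on \<open>S\<close>
  passes to the derivatives of every order. This matters wherever functions are built from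
  \<open>cinv\<close> and \<open>cmap\<close>, whose values off their domains are arbitrary.\<close>

lemma Ck_on_cong:
  assumes "open S" "\<And>x. x \<in> S \<Longrightarrow> f x = g x" "Ck_on k f S"
  shows "Ck_on k g S"
  using assms(2,3)
proof (induction k arbitrary: f g)
  case 0
  then show ?case by (simp cong: continuous_on_cong)
next
  case (Suc k)
  have D: "(g has_derivative frechet_derivative f (at x)) (at x)" if "x \<in> S" for x
    using Suc.prems that assms(1) has_derivative_transform_within_open[of f _ x UNIV S g]
    by (auto simp: frechet_derivative_works)
  have eq: "frechet_derivative f (at x) v = frechet_derivative g (at x) v" if "x \<in> S" for x v
    using frechet_derivative_at[OF D[OF that]] by simp
  have "Ck_on k (\<lambda>x. frechet_derivative g (at x) v) S" for v
    using Suc.prems(2) by (intro Suc.IH[OF eq]) simp_all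
  with D show ?case
    unfolding Ck_on.simps differentiable_def by blast
qed

text \<open>The differentiability clauses are pointwise; openness serves the continuity in the base
  case. Later this glues an object given on an open set to zero outside a closed subset.\<close>

lemma Ck_on_Un:
  assumes "open S" "open T" "Ck_on k f S" "Ck_on k f T"
  shows "Ck_on k f (S \<union> T)"
  using assms(3,4) by (induction k arbitrary: f) (auto simp: assms continuous_on_open_Un)

lemma Ck_on_const: "Ck_on k (\<lambda>x. c) S"
  by (induction k arbitrary: c) (auto simp: frechet_derivative_const)

text \<open>By uniqueness of the derivative, any explicit formula for it can stand in for
  \<open>frechet_derivative\<close>.\<close>

lemma Ck_on_SucI:
  assumes "open S" "\<And>x. x \<in> S \<Longrightarrow> (f has_derivative f' x) (at x)" "\<And>v. Ck_on k (\<lambda>x. f' x v) S"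
  shows "Ck_on (Suc k) f S"
proof -
  have "f' x = frechet_derivative f (at x)" if "x \<in> S" for x
    using assms(2)[OF that] by (rule frechet_derivative_at)
  then have "Ck_on k (\<lambda>x. frechet_derivative f (at x) v) S" for v
    using assms by (intro Ck_on_cong[OF assms(1) _ assms(3)]) simp
  then show ?thesis
    using assms(2) by (auto simp: differentiable_def)
qed

lemma Ck_on_add:
  assumes "open S" "Ck_on k f S" "Ck_on k g S"
  shows "Ck_on k (\<lambda>x. f x + g x) S"
  using assms(2,3)
proof (induction k arbitrary: f g)
  case 0
  then show ?case by (simp add: continuous_on_add)
next
  case (Suc k)
  then have C: "Ck_on k (\<lambda>x. frechet_derivative f (at x) v + frechet_derivative g (at x) v) S" for v
    by auto
  have D: "((\<lambda>x. f x + g x) has_derivative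
      (\<lambda>v. frechet_derivative f (at x) v + frechet_derivative g (at x) v)) (at x)"
    if "x \<in> S" for x
    using that Suc.prems by (auto intro!: has_derivative_add simp: frechet_derivative_works[symmetric])
  show ?case
    by (rule Ck_on_SucI[OF assms(1) D C])
qed

lemma Ck_on_sum:
  assumes "open S" "\<And>i. i \<in> I \<Longrightarrow> Ck_on k (f i) S"
  shows "Ck_on k (\<lambda>x. \<Sum>i\<in>I. f i x) S"
  using assms(2)
  by (induction I rule: infinite_finite_induct) (auto simp: Ck_on_const Ck_on_add[OF assms(1)])

lemma Ck_on_SucD: "Ck_on (Suc k) f S \<Longrightarrow> Ck_on k f S"
proof (induction k arbitrary: f)
  case 0
  then show ?case
    by (simp add: continuous_at_imp_continuous_on differentiable_imp_continuous_within)
next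
  case (Suc k)
  then show ?case by (metis Ck_on.simps(2))
qed

text \<open>The product rule, at once for scaling, inner products, real products and matrices acting
  on vectors. It also contains the undifferentiated factors, which is where
  \<open>Ck_on_SucD\<close> enters.\<close>

lemma Ck_on_bilinear:
  assumes "bounded_bilinear prd" "open S" "Ck_on k f S" "Ck_on k g S"
  shows "Ck_on k (\<lambda>x. prd (f x) (g x)) S"
  using assms(3,4)
proof (induction k arbitrary: f g)
  case 0
  then show ?case using bounded_bilinear.continuous_on[OF assms(1)] by auto
next
  case (Suc k)
  have D: "((\<lambda>x. prd (f x) (g x)) has_derivative
      (\<lambda>v. prd (f x) (frechet_derivative g (at x) v) + prd (frechet_derivative f (at x) v) (g x))) (at x)"
    if "x \<in> S" for x
    using that Suc.prems
    by (auto intro!: bounded_bilinear.FDERIV[OF assms(1)] simp: frechet_derivative_works[symmetric])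
  have "Ck_on k f S" "Ck_on k g S"
    using Suc.prems Ck_on_SucD by blast+
  then have C: "Ck_on k (\<lambda>x. prd (f x) (frechet_derivative g (at x) v) + prd (frechet_derivative f (at x) v) (g x)) S" for v
    using Suc by (auto intro!: Ck_on_add assms)
  show ?case
    by (rule Ck_on_SucI[OF assms(2) D C])
qed

lemma Ck_on_bounded_linear:
  assumes "bounded_linear f" shows "Ck_on k f S"
proof (cases k)
  case 0
  then show ?thesis using assms by (simp add: linear_continuous_on)
next
  case (Suc n)
  have "(f has_derivative f) (at x)" for x by (rule bounded_linear_imp_has_derivative[OF assms])
  then have "frechet_derivative f (at x) = f" "f differentiable (at x)" for x
    by (metis frechet_derivative_at, metis differentiable_def)
  then show ?thesis by (auto simp: Suc Ck_on_const)
qed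

lemma Ck_on_compose:
  fixes f :: "'b::euclidean_space \<Rightarrow> 'c::real_normed_vector" and g :: "'a::euclidean_space \<Rightarrow> 'b"
  assumes "open S" "Ck_on k f T" "Ck_on k g S" "g ` S \<subseteq> T"
  shows "Ck_on k (\<lambda>x. f (g x)) S"
  using assms(2,3)
proof (induction k arbitrary: f)
  case 0
  then show ?case using continuous_on_compose2 assms(4) by fastforce
next
  case (Suc k)
  \<comment> \<open>The chain rule puts an \<open>x\<close>-dependent direction into the derivative
    of \<open>f\<close>, whereas \<open>Ck_on\<close> controls fixed directions only. Expanding in
    \<open>Basis\<close> moves this dependence into scalar coefficients.\<close>
  let ?D = "\<lambda>x v. \<Sum>b\<in>Basis. (frechet_derivative g (at x) v \<bullet> b) *\<^sub>R frechet_derivative f (at (g x)) b"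
  have D: "((\<lambda>x. f (g x)) has_derivative ?D x) (at x)"
    if "x \<in> S" for x
  proof -
    have f': "(f has_derivative frechet_derivative f (at (g x))) (at (g x))"
      and g': "(g has_derivative frechet_derivative g (at x)) (at x)"
      using that Suc.prems assms(4) by (auto simp: frechet_derivative_works[symmetric])
    interpret linear "frechet_derivative f (at (g x))"
      using f' by (rule has_derivative_linear)
    have "frechet_derivative f (at (g x)) (frechet_derivative g (at x) v) = ?D x v" for v
      by (subst euclidean_representation[of "frechet_derivative g (at x) v", symmetric])
        (simp only: sum scale)
    with diff_chain_at[OF g' f'] show ?thesis
      by (simp add: o_def)
  qed
  have C: "Ck_on k (\<lambda>x. ?D x v) S" for v
  proof (intro Ck_on_sum assms(1) Ck_on_bilinear[OF bounded_bilinear_scaleR] Ck_on_bilinear[OF bounded_bilinear_inner] Ck_on_const)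
    show "Ck_on k (\<lambda>x. frechet_derivative g (at x) v) S"
      using Suc.prems by simp
    show "Ck_on k (\<lambda>x. frechet_derivative f (at (g x)) b) S" for b
      using Suc.prems by (intro Suc.IH Ck_on_SucD[OF Suc.prems(2)]) simp
  qed
  show ?case
    by (rule Ck_on_SucI[OF assms(1) D C])
qed

lemma bounded_bilinear_matrix_vector_mult:
  "bounded_bilinear ((*v) :: real ^ 'n ^ 'm \<Rightarrow> real ^ 'n \<Rightarrow> real ^ 'm)"
  by (auto simp: bilinear_conv_bounded_bilinear[symmetric] bilinear_def algebra_simps
      scaleR_matrix_vector_assoc intro!: linearI)

lemma Ck_on_vec:
  fixes f :: "'i::finite \<Rightarrow> 'a::euclidean_space \<Rightarrow> real"
  assumes "open S" "\<And>i. Ck_on k (f i) S"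
  shows "Ck_on k (\<lambda>x. \<chi> i. f i x) S"
proof -
  have "Ck_on k (\<lambda>x. \<Sum>i\<in>UNIV. f i x *\<^sub>R (axis i 1 :: real ^ 'i)) S"
    by (intro Ck_on_sum Ck_on_bilinear[OF bounded_bilinear_scaleR] Ck_on_const assms)
  moreover have "(\<Sum>i\<in>UNIV. f i x *\<^sub>R (axis i 1 :: real ^ 'i)) = (\<chi> i. f i x)" for x
    by (simp add: vec_eq_iff axis_def if_distrib cong: if_cong)
  ultimately show ?thesis by simp
qed

lemma inner_transpose_mult: "(transpose M *v a) \<bullet> b = a \<bullet> (M *v b)" for M :: "real ^ 'n ^ 'm"
  by (simp add: dot_lmul_matrix)

section \<open>Bump functions\<close>

text \<open>Allowing the powers of \<open>t\<close> makes the family closed under differentiation.\<close>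
definition flat_exp :: "nat \<Rightarrow> real \<Rightarrow> real" where
  "flat_exp m t = (if t > 0 then exp (- 1 / t) / t ^ m else 0)"

text \<open>The substitution \<open>x = 1 / t\<close> turns this into the decay of
  \<open>x ^ m / exp x\<close> at infinity.\<close>

lemma flat_exp_tendsto_0: "((\<lambda>t. exp (- 1 / t) / t ^ m) \<longlongrightarrow> (0::real)) (at_right 0)"
proof -
  have "((\<lambda>x. x ^ m / exp x) \<longlongrightarrow> (0::real)) at_top"
    by (rule tendsto_power_div_exp_0)
  then have "((\<lambda>t. inverse t ^ m / exp (inverse t)) \<longlongrightarrow> (0::real)) (at_right 0)"
    by (rule filterlim_compose) (rule filterlim_inverse_at_top_right)
  then show ?thesis
    by (simp add: exp_minus field_simps power_inverse)
qed

text \<open>For positive \<open>t\<close> this is the quotient rule. At \<open>0\<close> the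
  difference quotient is the family member with exponent \<open>m + 1\<close>, which tends to
  \<open>0\<close>.\<close>

lemma flat_exp_has_derivative:
  "(flat_exp m has_real_derivative (flat_exp (m + 2) t - real m * flat_exp (m + 1) t)) (at t)"
proof (cases t "0::real" rule: linorder_cases)
  case less
  have "((\<lambda>t. 0) has_real_derivative 0) (at t)" by simp
  then show ?thesis
    using has_field_derivative_transform_within_open[of "\<lambda>t. 0" 0 t "{..<0}" "flat_exp m"] less
    by (simp add: flat_exp_def)
next
  case greater
  have "((\<lambda>t. exp (- 1 / t) / t ^ m) has_real_derivative (flat_exp (m + 2) t - real m * flat_exp (m + 1) t)) (at t)"
  proof (cases m)
    case 0
    then show ?thesis
      using greater by (auto intro!: derivative_eq_intros simp: flat_exp_def power2_eq_square)
  next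
    case (Suc j)
    \<comment> \<open>The subtraction truncates at \<open>j = 0\<close>, where the factor
      \<open>real j\<close> makes both sides vanish.\<close>
    have "real j * t ^ (j - Suc 0) * t = real j * t ^ j"
      by (cases j) auto
    then show ?thesis
      using greater Suc
      by (auto intro!: derivative_eq_intros simp: flat_exp_def divide_simps) (simp add: algebra_simps)
  qed
  then show ?thesis
    by (rule has_field_derivative_transform_within_open[of _ _ _ "{0<..}"]) (simp_all add: flat_exp_def greater)
next
  case equal
  have "((\<lambda>y. flat_exp m y / y) \<longlongrightarrow> 0) (at 0)"
  proof (subst filterlim_at_split, intro conjI)
    show "((\<lambda>y. flat_exp m y / y) \<longlongrightarrow> 0) (at_left 0)"
      by (rule tendsto_eventually) (auto simp: eventually_at_filter flat_exp_def)
    show "((\<lambda>y. flat_exp m y / y) \<longlongrightarrow> 0) (at_right 0)"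
      using flat_exp_tendsto_0[of "Suc m"]
      by (rule Lim_transform_eventually) (auto simp: eventually_at_filter flat_exp_def mult.commute)
  qed
  then show ?thesis
    unfolding has_field_derivative_iff equal by (simp add: flat_exp_def)
qed

lemma Ck_on_flat_exp: "Ck_on k (flat_exp m) UNIV"
proof (induction k arbitrary: m)
  case 0
  show ?case
    using DERIV_isCont[OF flat_exp_has_derivative] by (simp add: continuous_at_imp_continuous_on)
next
  case (Suc k)
  have D: "(flat_exp m has_derivative (\<lambda>v. (flat_exp (m + 2) t + (- real m) *\<^sub>R flat_exp (m + 1) t) *\<^sub>R v)) (at t)" for t
    using flat_exp_has_derivative[of m t] unfolding has_field_derivative_def
    by (rule has_derivative_eq_rhs) (simp add: fun_eq_iff mult.commute)
  have "Ck_on k (\<lambda>t. (flat_exp (m + 2) t + (- real m) *\<^sub>R flat_exp (m + 1) t) *\<^sub>R v) UNIV" for v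
    by (intro Ck_on_bilinear[OF bounded_bilinear_scaleR] Ck_on_add Ck_on_const Suc open_UNIV)
  then show ?case
    by (intro Ck_on_SucI[OF open_UNIV D])
qed

text \<open>The squared distance, unlike the distance itself, is smooth at \<open>a\<close>, and it
  is stationary there, so that the bump has derivative \<open>0\<close> at its centre. For positive
  \<open>r\<close>, the denominator normalises the value at \<open>a\<close> to
  \<open>1\<close>.\<close>

definition bump :: "real \<Rightarrow> 'a::euclidean_space \<Rightarrow> 'a \<Rightarrow> real" where
  "bump r a x = flat_exp 0 (r\<^sup>2 - (x - a) \<bullet> (x - a)) / flat_exp 0 (r\<^sup>2)"

lemma bump_center: "r > 0 \<Longrightarrow> bump r a a = 1"
  by (simp add: bump_def flat_exp_def)

lemma bump_eq_0:
  assumes "r > 0" "x \<notin> cball a r" shows "bump r a x = 0"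
proof -
  have "r\<^sup>2 < (norm (x - a))\<^sup>2"
    using assms by (intro power_strict_mono) (auto simp: dist_norm norm_minus_commute)
  then show ?thesis
    by (simp add: bump_def flat_exp_def power2_norm_eq_inner)
qed

lemma Ck_on_diff_const:
  assumes "open S"
  shows "Ck_on k (\<lambda>x. x - a) S"
  using Ck_on_add[OF assms Ck_on_bounded_linear[OF bounded_linear_ident] Ck_on_const[of _ "- a"]]
  by simp

lemma Ck_on_bump: "Ck_on k (bump r a) UNIV"
proof -
  \<comment> \<open>The difference is written as a sum with a multiple by \<open>-1\<close>, so that
    the rules for sums and bilinear products apply.\<close>
  have 1: "Ck_on k (\<lambda>x. r\<^sup>2 + (-1) *\<^sub>R ((x - a) \<bullet> (x - a))) UNIV"
    by (intro Ck_on_add Ck_on_bilinear[OF bounded_bilinear_inner] Ck_on_diff_const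
        Ck_on_bilinear[OF bounded_bilinear_scaleR] Ck_on_const open_UNIV)
  have "Ck_on k (\<lambda>x. (1 / flat_exp 0 (r\<^sup>2)) *\<^sub>R flat_exp 0 (r\<^sup>2 + (-1) *\<^sub>R ((x - a) \<bullet> (x - a)))) UNIV"
    by (intro Ck_on_bilinear[OF bounded_bilinear_scaleR] Ck_on_const open_UNIV
      Ck_on_compose[OF open_UNIV Ck_on_flat_exp 1]) simp
  then show ?thesis
    by (simp add: bump_def[abs_def])
qed

lemma bump_has_derivative_center: "(bump r a has_derivative (\<lambda>v. 0)) (at a)"
proof -
  have 1: "((\<lambda>x. r\<^sup>2 - (x - a) \<bullet> (x - a)) has_derivative (\<lambda>v. 0)) (at a)"
    by (auto intro!: derivative_eq_intros)
  have 2: "(flat_exp 0 has_derivative (*) (flat_exp 2 (r\<^sup>2))) (at (r\<^sup>2 - (a - a) \<bullet> (a - a)))"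
    using flat_exp_has_derivative[of 0 "r\<^sup>2"]
    by (simp add: has_field_derivative_def numeral_2_eq_2)
  have "((\<lambda>x. flat_exp 0 (r\<^sup>2 - (x - a) \<bullet> (x - a)) / flat_exp 0 (r\<^sup>2)) has_derivative (\<lambda>v. 0 / flat_exp 0 (r\<^sup>2))) (at a)"
    using has_derivative_compose[OF 1 2] by (intro bounded_linear.has_derivative[OF bounded_linear_divide]) simp
  then show ?thesis
    by (simp add: bump_def[abs_def])
qed

section \<open>Extension from a chart to the manifold\<close>

context
  fixes A :: "('m::{t2_space, second_countable_topology}, 'n::finite) chart set"
  assumes atlas: "smooth_atlas A"
begin

section \<open>Charts and coordinate changes\<close>

lemma chart_homeomorphism:
  "c \<in> A \<Longrightarrow> homeomorphism (cdom c) (cmap c ` cdom c) (cmap c) (cinv c)"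
  using atlas by (auto simp: smooth_atlas_def is_chart_def)

lemma cinv_cmap: "c \<in> A \<Longrightarrow> p \<in> cdom c \<Longrightarrow> cinv c (cmap c p) = p"
  using chart_homeomorphism by (auto simp: homeomorphism_def)

lemma cinv_in: "x \<in> cmap c ` cdom c \<Longrightarrow> cinv c x \<in> cdom c"
  by (rule inv_into_into)

lemma open_cdom: "c \<in> A \<Longrightarrow> open (cdom c)"
  using atlas by (auto simp: smooth_atlas_def is_chart_def)

text \<open>The image is the preimage of \<open>V\<close> under the continuous map
  \<open>cinv c\<close> on the open coordinate range of \<open>c\<close>.\<close>

lemma open_cmap_image:
  assumes "c \<in> A" "open V"
  shows "open (cmap c ` (cdom c \<inter> V))"
proof -
  have "open (cmap c ` cdom c)"
    using assms atlas by (auto simp: smooth_atlas_def is_chart_def)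
  moreover have "continuous_on (cmap c ` cdom c) (cinv c)"
    using chart_homeomorphism[OF assms(1)] by (simp add: homeomorphism_def)
  ultimately have "open (cmap c ` cdom c \<inter> cinv c -` V)"
    using assms(2) by (metis continuous_open_preimage)
  moreover have "cmap c ` (cdom c \<inter> V) = cmap c ` cdom c \<inter> cinv c -` V"
    by (auto simp: cinv_cmap[OF assms(1)])
  ultimately show ?thesis by simp
qed

lemma open_cmap_cdom: "c \<in> A \<Longrightarrow> open (cmap c ` cdom c)"
  using open_cmap_image[of c UNIV] by simp

lemma chart_at: "chart_at A p \<in> A" "p \<in> cdom (chart_at A p)"
proof -
  have "\<exists>c. c \<in> A \<and> p \<in> cdom c"
    using atlas unfolding smooth_atlas_def by blast
  then show "chart_at A p \<in> A" "p \<in> cdom (chart_at A p)"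
    unfolding chart_at_def by (metis (mono_tags, lifting) someI_ex)+
qed

lemma Ck_on_transition:
  assumes "c \<in> A" "d \<in> A"
  shows "Ck_on k (\<lambda>x. cmap d (cinv c x)) (cmap c ` (cdom c \<inter> cdom d))"
  using atlas assms by (auto simp: smooth_atlas_def smooth_on_def o_def)

lemma transition_has_derivative:
  assumes "c \<in> A" "d \<in> A" "p \<in> cdom c \<inter> cdom d"
  shows "((\<lambda>x. cmap d (cinv c x)) has_derivative (*v) (jac c d p)) (at (cmap c p))"
proof -
  have "(\<lambda>x. cmap d (cinv c x)) differentiable (at (cmap c p))"
    using Ck_on_transition[OF assms(1,2), of "Suc 0"] assms(3) by auto
  then show ?thesis
    by (simp add: jacobian_works jac_def o_def)
qed

section \<open>Smooth functions and their differentials\<close>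

lemma Ck_on_smooth_function:
  "smooth_function A f \<Longrightarrow> c \<in> A \<Longrightarrow> Ck_on k (\<lambda>x. f (cinv c x)) (cmap c ` cdom c)"
  by (simp add: smooth_function_def smooth_components_def smooth_on_def)

text \<open>\<open>differential\<close> stores only the partial derivatives; linearity recovers the
  total derivative from its values on the standard basis.\<close>

lemma smooth_function_has_derivative:
  assumes "smooth_function A f" "c \<in> A" "p \<in> cdom c"
  shows "((\<lambda>x. f (cinv c x)) has_derivative (\<lambda>v. differential A f p c \<bullet> v)) (at (cmap c p))"
proof -
  let ?D = "frechet_derivative (\<lambda>x. f (cinv c x)) (at (cmap c p))"
  have D: "((\<lambda>x. f (cinv c x)) has_derivative ?D) (at (cmap c p))"
    using Ck_on_smooth_function[OF assms(1,2), of "Suc 0"] assms(3) by (simp add: frechet_derivative_works)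
  interpret linear ?D
    using D by (rule has_derivative_linear)
  have "?D v = differential A f p c \<bullet> v" for v
  proof -
    have "?D (\<Sum>i\<in>UNIV. v $ i *\<^sub>R axis i 1) = (\<Sum>i\<in>UNIV. v $ i * ?D (axis i 1))"
      unfolding sum scale real_scaleR_def ..
    moreover have "(\<Sum>i\<in>UNIV. v $ i *\<^sub>R axis i 1) = v"
      using basis_expansion[of v] by (simp only: scalar_mult_eq_scaleR)
    ultimately show ?thesis
      using assms by (simp add: differential_def o_def inner_vec_def mult.commute)
  qed
  with D show ?thesis
    by (metis has_derivative_eq_rhs ext)
qed

lemma differential_eqI:
  assumes "smooth_function A f" "c \<in> A" "p \<in> cdom c"
    and "((\<lambda>x. f (cinv c x)) has_derivative (\<lambda>v. b \<bullet> v)) (at (cmap c p))"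
  shows "differential A f p c = b"
  using has_derivative_unique[OF smooth_function_has_derivative[OF assms(1-3)] assms(4)]
  by (metis vector_eq_rdot)

text \<open>The transformation law determines the components in every chart around \<open>p\<close>
  from those in one, and all other entries are \<open>0\<close> by convention. Covectors can thus be
  compared in a single chart.\<close>

lemma cotangent_eqI:
  assumes \<alpha>: "\<alpha> \<in> cotangent_space A p" and \<beta>: "\<beta> \<in> cotangent_space A p"
    and c: "c \<in> A" "p \<in> cdom c" and eq: "\<alpha> c = \<beta> c"
  shows "\<alpha> = \<beta>"
proof
  fix d
  show "\<alpha> d = \<beta> d"
  proof (cases "d \<in> A \<and> p \<in> cdom d")
    case True
    then have "\<alpha> d = transpose (jac d c p) *v \<alpha> c" "\<beta> d = transpose (jac d c p) *v \<beta> c"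
      using \<alpha> \<beta> c unfolding cotangent_space_def by blast+
    then show ?thesis
      by (simp only: eq)
  next
    case False
    then have "\<alpha> d = 0" "\<beta> d = 0"
      using \<alpha> \<beta> unfolding cotangent_space_def by blast+
    then show ?thesis by simp
  qed
qed

lemma cotangent_space_0: "(\<lambda>c. 0) \<in> cotangent_space A p"
  by (simp add: cotangent_space_def)

text \<open>Near the point, \<open>f\<close> read in \<open>c\<close> is \<open>f\<close> read in
  \<open>d\<close> after the coordinate change, so the chain rule produces the transposed
  Jacobian.\<close>

lemma differential_cotangent:
  assumes f: "smooth_function A f"
  shows "differential A f p \<in> cotangent_space A p"
proof -
  have "differential A f p c = transpose (jac c d p) *v differential A f p d"
    if c: "c \<in> A" and d: "d \<in> A" and p: "p \<in> cdom c \<inter> cdom d" for c d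
  proof (rule differential_eqI[OF f c])
    have p': "cinv c (cmap c p) = p"
      using c p by (simp add: cinv_cmap)
    then have D: "((\<lambda>x. f (cinv d x)) has_derivative (\<lambda>v. differential A f p d \<bullet> v)) (at (cmap d (cinv c (cmap c p))))"
      using smooth_function_has_derivative[OF f d] p by simp
    have "((\<lambda>x. f (cinv d (cmap d (cinv c x)))) has_derivative
        (\<lambda>v. (transpose (jac c d p) *v differential A f p d) \<bullet> v)) (at (cmap c p))"
      using has_derivative_compose[OF transition_has_derivative[OF c d p] D]
      by (simp only: inner_transpose_mult)
    then show "((\<lambda>x. f (cinv c x)) has_derivative
        (\<lambda>v. (transpose (jac c d p) *v differential A f p d) \<bullet> v)) (at (cmap c p))"
      by (rule has_derivative_transform_within_open[OF _ open_cmap_image[OF c open_cdom[OF d]]])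
        (use c d p in \<open>auto simp: cinv_cmap\<close>)
  qed (use p in simp)
  moreover have "differential A f p c = 0" if "\<not> (c \<in> A \<and> p \<in> cdom c)" for c
    using that by (auto simp: differential_def)
  ultimately show ?thesis
    unfolding cotangent_space_def mem_Collect_eq by blast
qed

lemma one_form_differential:
  assumes f: "smooth_function A f"
  shows "one_form A (differential A f)"
proof -
  have "Ck_on k (\<lambda>x. differential A f (cinv c x) c) (cmap c ` cdom c)" if c: "c \<in> A" for c k
  proof (rule Ck_on_cong[OF open_cmap_cdom[OF c]])
    show "Ck_on k (\<lambda>x. \<chi> i. frechet_derivative (\<lambda>x. f (cinv c x)) (at x) (axis i 1)) (cmap c ` cdom c)"
      using Ck_on_smooth_function[OF f c, of "Suc k"] by (intro Ck_on_vec open_cmap_cdom c) simp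
  qed (use c in \<open>auto simp: differential_def o_def cinv_cmap\<close>)
  then show ?thesis
    using f by (auto simp: one_form_def differential_cotangent smooth_components_def smooth_on_def)
qed

text \<open>Compact sets in a Hausdorff space are closed, so \<open>cdom c\<close> and the
  complement of the image of the ball form an open cover. On the first set the function is
  \<open>f\<close> in coordinates, on the second it is zero.\<close>

lemma smooth_function_extend:
  assumes c: "c \<in> A" and f: "\<And>k. Ck_on k f UNIV"
    and sub: "cball a r \<subseteq> cmap c ` cdom c" and out: "\<And>x. x \<notin> cball a r \<Longrightarrow> f x = 0"
  shows "closed (cinv c ` cball a r)"
    and "smooth_function A (\<lambda>q. if q \<in> cdom c then f (cmap c q) else 0)"
proof -
  let ?h = "\<lambda>q. if q \<in> cdom c then f (cmap c q) else 0"
  let ?K = "cinv c ` cball a r"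
  have "continuous_on (cball a r) (cinv c)"
    using chart_homeomorphism[OF c] sub by (auto simp: homeomorphism_def intro: continuous_on_subset)
  then show K: "closed ?K"
    by (intro compact_imp_closed compact_continuous_image compact_cball)
  have h0: "?h q = 0" if "q \<notin> ?K" for q
  proof (cases "q \<in> cdom c")
    case True
    have "cmap c q \<notin> cball a r"
      using True that cinv_cmap[OF c True] by (metis imageI)
    then show ?thesis by (simp add: out)
  qed simp
  have "Ck_on k (\<lambda>x. ?h (cinv d x)) (cmap d ` cdom d)" if d: "d \<in> A" for d k
  proof -
    have 1: "Ck_on k (\<lambda>x. ?h (cinv d x)) (cmap d ` (cdom d \<inter> cdom c))"
    proof (rule Ck_on_cong[OF open_cmap_image[OF d open_cdom[OF c]]])
      show "Ck_on k (\<lambda>x. f (cmap c (cinv d x))) (cmap d ` (cdom d \<inter> cdom c))"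
        by (rule Ck_on_compose[OF open_cmap_image[OF d open_cdom[OF c]] f Ck_on_transition[OF d c]]) simp
    qed (auto simp: cinv_cmap[OF d])
    have 2: "Ck_on k (\<lambda>x. ?h (cinv d x)) (cmap d ` (cdom d \<inter> - ?K))"
    proof (rule Ck_on_cong[OF open_cmap_image[OF d open_Compl[OF K]] _ Ck_on_const])
      show "0 = ?h (cinv d x)" if x: "x \<in> cmap d ` (cdom d \<inter> - ?K)" for x
      proof -
        obtain q where q: "q \<in> cdom d" "q \<notin> ?K" "x = cmap d q"
          using x by blast
        then show ?thesis
          using h0[OF q(2)] by (simp only: cinv_cmap[OF d q(1)])
      qed
    qed
    have "?K \<subseteq> cdom c"
      by (intro image_subsetI cinv_in subsetD[OF sub])
    then have "cdom d = cdom d \<inter> cdom c \<union> cdom d \<inter> - ?K"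
      by auto
    then have "cmap d ` cdom d = cmap d ` (cdom d \<inter> cdom c) \<union> cmap d ` (cdom d \<inter> - ?K)"
      by (metis image_Un)
    then show ?thesis
      using Ck_on_Un[OF open_cmap_image[OF d open_cdom[OF c]] open_cmap_image[OF d open_Compl[OF K]] 1 2]
      by simp
  qed
  then show "smooth_function A ?h"
    by (simp add: smooth_function_def smooth_components_def smooth_on_def)
qed

lemma chart_ball:
  assumes "c \<in> A" "p \<in> cdom c" "open U" "p \<in> U"
  obtains r where "r > 0" "cball (cmap c p) r \<subseteq> cmap c ` (cdom c \<inter> U)"
  using open_cmap_image[OF assms(1,3)] assms(2,4) unfolding open_contains_cball by blast

text \<open>The closed set \<open>K\<close> is part of the result because extending a local field by
  zero relies on the open cover by \<open>U\<close> and the complement of \<open>K\<close>.\<close>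

lemma bump_function:
  assumes "open U" "p \<in> U"
  obtains \<psi> K where "smooth_function A \<psi>" "\<psi> p = 1" "differential A \<psi> p = (\<lambda>c. 0)"
    "closed K" "K \<subseteq> U" "\<And>q. q \<notin> K \<Longrightarrow> \<psi> q = 0"
proof -
  define c where "c = chart_at A p"
  have c: "c \<in> A" and p: "p \<in> cdom c"
    by (simp_all add: c_def chart_at)
  let ?a = "cmap c p"
  obtain r where r: "r > 0" "cball ?a r \<subseteq> cmap c ` (cdom c \<inter> U)"
    using chart_ball[OF c p assms] .
  then have sub: "cball ?a r \<subseteq> cmap c ` cdom c" by blast
  define \<psi> where "\<psi> q = (if q \<in> cdom c then bump r ?a (cmap c q) else 0)" for q
  note ext = smooth_function_extend[OF c Ck_on_bump sub bump_eq_0[OF r(1)]]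
  have \<psi>: "smooth_function A \<psi>"
    using ext(2) by (simp add: \<psi>_def[abs_def])
  have dc: "differential A \<psi> p c = 0"
  proof (rule differential_eqI[OF \<psi> c p])
    show "((\<lambda>x. \<psi> (cinv c x)) has_derivative (\<lambda>v. 0 \<bullet> v)) (at ?a)"
      unfolding inner_zero_left
      by (rule has_derivative_transform_within_open[OF bump_has_derivative_center open_cmap_cdom[OF c]])
        (use p in \<open>auto simp: \<psi>_def cinv_cmap[OF c]\<close>)
  qed
  show thesis
  proof
    show "smooth_function A \<psi>" by fact
    show "\<psi> p = 1"
      using p r(1) by (simp add: \<psi>_def bump_center)
    show "differential A \<psi> p = (\<lambda>c. 0)"
      using cotangent_eqI[OF differential_cotangent[OF \<psi>] cotangent_space_0 c p dc] .
    show "closed (cinv c ` cball ?a r)"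
      by (rule ext(1))
    show "cinv c ` cball ?a r \<subseteq> U"
      using r(2) cinv_cmap[OF c] by fastforce
    show "\<psi> q = 0" if "q \<notin> cinv c ` cball ?a r" for q
    proof (cases "q \<in> cdom c")
      case True
      then have "cmap c q \<notin> cball ?a r"
        using that cinv_cmap[OF c True] by (metis imageI)
      then show ?thesis by (simp add: \<psi>_def bump_eq_0 r(1))
    qed (simp add: \<psi>_def)
  qed
qed

text \<open>The witness is a bump times the linear function with gradient \<open>b\<close> that
  vanishes at the centre. There the bump has value \<open>1\<close> and derivative \<open>0\<close>,
  so the product rule leaves exactly \<open>b\<close>.\<close>

lemma exists_differential:
  assumes c: "c \<in> A" and p: "p \<in> cdom c"
  obtains h where "smooth_function A h" "differential A h p c = b"
proof -
  let ?a = "cmap c p"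
  obtain r where r: "r > 0" "cball ?a r \<subseteq> cmap c ` (cdom c \<inter> UNIV)"
    using chart_ball[OF c p open_UNIV] by blast
  define f where "f x = bump r ?a x * (b \<bullet> (x - ?a))" for x
  have f: "Ck_on k f UNIV" for k
    unfolding f_def[abs_def]
    by (intro Ck_on_bilinear[OF bounded_bilinear_mult] Ck_on_bilinear[OF bounded_bilinear_inner] Ck_on_bump
        Ck_on_const Ck_on_diff_const open_UNIV)
  have f0: "f x = 0" if "x \<notin> cball ?a r" for x
    using that r(1) by (simp add: f_def bump_eq_0)
  define h where "h q = (if q \<in> cdom c then f (cmap c q) else 0)" for q
  have h: "smooth_function A h"
    using smooth_function_extend(2)[OF c f _ f0] r(2) by (simp add: h_def[abs_def])
  have "(f has_derivative (\<lambda>v. bump r ?a ?a * (b \<bullet> v) + 0 * (b \<bullet> (?a - ?a)))) (at ?a)"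
    unfolding f_def[abs_def]
    by (intro has_derivative_mult bump_has_derivative_center) (auto intro!: derivative_eq_intros)
  then have f': "(f has_derivative (\<lambda>v. b \<bullet> v)) (at ?a)"
    using r(1) by (simp add: bump_center)
  have dc: "differential A h p c = b"
    by (rule differential_eqI[OF h c p])
      (rule has_derivative_transform_within_open[OF f' open_cmap_cdom[OF c]],
        use p in \<open>auto simp: h_def cinv_cmap[OF c]\<close>)
  with h show thesis
    using that by blast
qed

lemma cotangent_eq_differential:
  assumes \<beta>: "\<beta> \<in> cotangent_space A p"
  obtains h where "smooth_function A h" "differential A h p = \<beta>"
proof -
  define c where "c = chart_at A p"
  have c: "c \<in> A" and p: "p \<in> cdom c"
    by (simp_all add: c_def chart_at)
  obtain h where h: "smooth_function A h" and dc: "differential A h p c = \<beta> c"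
    using exists_differential[OF c p] .
  have "differential A h p = \<beta>"
    using cotangent_eqI[OF differential_cotangent[OF h] \<beta> c p dc] .
  then show thesis
    using h that by blast
qed

lemma differential_zero: "differential A (\<lambda>q. 0) p = (\<lambda>c. 0)"
  by (auto simp: differential_def fun_eq_iff o_def vec_eq_iff)

section \<open>Tangent vectors and the cutting off of local fields\<close>

lemma Ck_on_vector_field:
  "vector_field A U X \<Longrightarrow> c \<in> A \<Longrightarrow> Ck_on k (\<lambda>x. X (cinv c x) c) (cmap c ` (cdom c \<inter> U))"
  by (simp add: vector_field_def smooth_components_def smooth_on_def)

lemma tangent_spaceI:
  assumes "\<And>c d. c \<in> A \<Longrightarrow> d \<in> A \<Longrightarrow> p \<in> cdom c \<inter> cdom d \<Longrightarrow> v d = jac c d p *v v c"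
    and "\<And>c. \<not> (c \<in> A \<and> p \<in> cdom c) \<Longrightarrow> v c = 0"
  shows "v \<in> tangent_space A p"
  using assms unfolding tangent_space_def mem_Collect_eq by blast

lemma tangent_spaceD:
  assumes "v \<in> tangent_space A p"
  shows "c \<in> A \<Longrightarrow> d \<in> A \<Longrightarrow> p \<in> cdom c \<inter> cdom d \<Longrightarrow> v d = jac c d p *v v c"
    and "\<not> (c \<in> A \<and> p \<in> cdom c) \<Longrightarrow> v c = 0"
  using assms unfolding tangent_space_def mem_Collect_eq by blast+

lemma tangent_space_0: "(\<lambda>c. 0) \<in> tangent_space A p"
  by (rule tangent_spaceI) simp_all

lemma tangent_space_scaleR:
  assumes v: "v \<in> tangent_space A p"
  shows "(\<lambda>c. a *\<^sub>R v c) \<in> tangent_space A p"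
  by (rule tangent_spaceI)
    (metis tangent_spaceD(1)[OF v] matrix_vector_mult_scaleR, simp add: tangent_spaceD(2)[OF v])

lemma tangent_space_diff:
  assumes v: "v \<in> tangent_space A p" and w: "w \<in> tangent_space A p"
  shows "(\<lambda>c. v c - w c) \<in> tangent_space A p"
  by (rule tangent_spaceI)
    (metis tangent_spaceD(1)[OF v] tangent_spaceD(1)[OF w] matrix_vector_mult_diff_distrib,
      simp add: tangent_spaceD(2)[OF v] tangent_spaceD(2)[OF w])

text \<open>The case distinction yields the zero vector outside \<open>U\<close> for every
  \<open>\<psi>\<close>, whatever \<open>X\<close> is there.\<close>

definition cut_off :: "('m \<Rightarrow> real) \<Rightarrow> 'm set \<Rightarrow> ('m \<Rightarrow> ('m, 'n) chart \<Rightarrow> real ^ 'n) \<Rightarrow>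
    'm \<Rightarrow> ('m, 'n) chart \<Rightarrow> real ^ 'n" where
  "cut_off \<psi> U X q c = (if q \<in> U then \<psi> q *\<^sub>R X q c else 0)"

text \<open>The field is a product of smooth factors on \<open>U\<close> and zero off
  \<open>K\<close>, and these two open sets cover the manifold.\<close>

lemma vector_field_cut_off:
  assumes U: "open U" and X: "vector_field A U X" and \<psi>: "smooth_function A \<psi>"
    and K: "closed K" "K \<subseteq> U" "\<And>q. q \<notin> K \<Longrightarrow> \<psi> q = 0"
  shows "vector_field A UNIV (cut_off \<psi> U X)"
proof -
  have T: "cut_off \<psi> U X q \<in> tangent_space A q" for q
    using X tangent_space_0 tangent_space_scaleR
    by (cases "q \<in> U") (auto simp: cut_off_def[abs_def] vector_field_def)
  have "Ck_on k (\<lambda>x. cut_off \<psi> U X (cinv d x) d) (cmap d ` cdom d)" if d: "d \<in> A" for d k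
  proof -
    have 0: "Ck_on k (\<lambda>x. \<psi> (cinv d x)) (cmap d ` (cdom d \<inter> U))"
      by (rule Ck_on_subset[OF Ck_on_smooth_function[OF \<psi> d]]) auto
    have 1: "Ck_on k (\<lambda>x. cut_off \<psi> U X (cinv d x) d) (cmap d ` (cdom d \<inter> U))"
      by (rule Ck_on_cong[OF open_cmap_image[OF d U] _
            Ck_on_bilinear[OF bounded_bilinear_scaleR open_cmap_image[OF d U] 0 Ck_on_vector_field[OF X d]]])
        (auto simp: cinv_cmap[OF d] cut_off_def)
    have 2: "Ck_on k (\<lambda>x. cut_off \<psi> U X (cinv d x) d) (cmap d ` (cdom d \<inter> - K))"
      by (rule Ck_on_cong[OF open_cmap_image[OF d open_Compl[OF K(1)]] _ Ck_on_const[of _ 0]])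
        (use K(3) in \<open>auto simp: cinv_cmap[OF d] cut_off_def\<close>)
    have "cdom d = cdom d \<inter> U \<union> cdom d \<inter> - K"
      using K(2) by auto
    then have "cmap d ` cdom d = cmap d ` (cdom d \<inter> U) \<union> cmap d ` (cdom d \<inter> - K)"
      by (metis image_Un)
    then show ?thesis
      using Ck_on_Un[OF open_cmap_image[OF d U] open_cmap_image[OF d open_Compl[OF K(1)]] 1 2]
      by simp
  qed
  with T show ?thesis
    by (simp add: vector_field_def smooth_components_def smooth_on_def)
qed

text \<open>Since \<open>d\<psi>\<close> vanishes at \<open>p\<close>, cutting off does not change the first derivatives there.\<close>
lemma lie_bracket_cut_off:
  assumes U: "open U" "p \<in> U" and X: "vector_field A U X" and Y: "vector_field A U Y"
    and \<psi>: "smooth_function A \<psi>" "\<psi> p = 1" "differential A \<psi> p = (\<lambda>c. 0)"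
  shows "lie_bracket A (cut_off \<psi> U X) (cut_off \<psi> U Y) p = lie_bracket A X Y p"
proof
  fix c
  have "frechet_derivative (\<lambda>x. cut_off \<psi> U Z (cinv c x) c) (at (cmap c p)) =
      frechet_derivative (\<lambda>x. Z (cinv c x) c) (at (cmap c p))"
    if Z: "vector_field A U Z" and c: "c \<in> A" and p: "p \<in> cdom c" for Z
  proof -
    let ?D = "frechet_derivative (\<lambda>x. Z (cinv c x) c) (at (cmap c p))"
    have p': "cmap c p \<in> cmap c ` (cdom c \<inter> U)"
      using p U by simp
    have "((\<lambda>x. Z (cinv c x) c) has_derivative ?D) (at (cmap c p))"
      using Ck_on_vector_field[OF Z c, of "Suc 0"] p U(2) by (simp add: frechet_derivative_works)
    from has_derivative_scaleR[OF smooth_function_has_derivative[OF \<psi>(1) c p] this]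
    have "((\<lambda>x. \<psi> (cinv c x) *\<^sub>R Z (cinv c x) c) has_derivative ?D) (at (cmap c p))"
      by (simp add: \<psi> cinv_cmap[OF c p])
    then have "((\<lambda>x. cut_off \<psi> U Z (cinv c x) c) has_derivative ?D) (at (cmap c p))"
      by (rule has_derivative_transform_within_open[OF _ open_cmap_image[OF c U(1)] p'])
        (auto simp: cut_off_def cinv_cmap[OF c])
    then show ?thesis
      by (rule frechet_derivative_at[symmetric])
  qed
  with X Y show "lie_bracket A (cut_off \<psi> U X) (cut_off \<psi> U Y) p c = lie_bracket A X Y p c"
    using U \<psi> by (simp add: lie_bracket_def cut_off_def)
qed

section \<open>The orthogonal complement of the leaves\<close>

text \<open>The transposed Jacobian in the law of \<open>P\<close> turns the components of the
  covector in \<open>d\<close> into those in \<open>c\<close>; the Jacobian that remains gives the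
  law of a vector.\<close>

lemma vector_field_anchor:
  assumes P: "bivector_field A P" and \<alpha>: "one_form A \<alpha>"
  shows "vector_field A UNIV (\<lambda>q. anchor (P q) (\<alpha> q))"
proof -
  have "anchor (P q) (\<alpha> q) \<in> tangent_space A q" for q
  proof -
    have \<alpha>q: "\<alpha> q \<in> cotangent_space A q"
      using \<alpha> by (simp add: one_form_def)
    have "P q d *v \<alpha> q d = jac c d q *v (P q c *v \<alpha> q c)"
      if "c \<in> A" "d \<in> A" "q \<in> cdom c \<inter> cdom d" for c d
    proof -
      have "\<alpha> q c = transpose (jac c d q) *v \<alpha> q d"
        using \<alpha>q that unfolding cotangent_space_def by blast
      moreover have "P q d = jac c d q ** P q c ** transpose (jac c d q)"
        using P that unfolding bivector_field_def by blast
      ultimately show ?thesis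
        by (simp only: matrix_vector_mul_assoc[symmetric])
    qed
    moreover have "P q c *v \<alpha> q c = 0" if "\<not> (c \<in> A \<and> q \<in> cdom c)" for c
    proof -
      have "\<alpha> q c = 0"
        using \<alpha>q that unfolding cotangent_space_def by blast
      then show ?thesis by simp
    qed
    ultimately show ?thesis
      unfolding tangent_space_def mem_Collect_eq anchor_def by blast
  qed
  moreover have "Ck_on k (\<lambda>x. P (cinv c x) c *v \<alpha> (cinv c x) c) (cmap c ` cdom c)" if "c \<in> A" for c k
    using P \<alpha> that
    by (intro Ck_on_bilinear[OF bounded_bilinear_matrix_vector_mult open_cmap_cdom])
      (auto simp: bivector_field_def one_form_def smooth_components_def smooth_on_def)
  ultimately show ?thesis
    by (simp add: vector_field_def smooth_components_def smooth_on_def anchor_def)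
qed

text \<open>Extending the covector first and applying \<open>P\<close> afterwards keeps the
  extension tangent to the leaves at every point, which an arbitrary extension of \<open>w\<close>
  would not ensure.\<close>

lemma leaf_tangent_eq_vector_field:
  assumes P: "bivector_field A P" and w: "w \<in> leaf_tangent A P p"
  obtains Z where "section_of A UNIV (leaf_tangent A P) Z" "Z p = w"
proof -
  obtain \<beta> where \<beta>: "\<beta> \<in> cotangent_space A p" "w = anchor (P p) \<beta>"
    using w by (auto simp: leaf_tangent_def)
  obtain h where h: "smooth_function A h" "differential A h p = \<beta>"
    using cotangent_eq_differential[OF \<beta>(1)] .
  show thesis
  proof
    show "section_of A UNIV (leaf_tangent A P) (\<lambda>q. anchor (P q) (differential A h q))"
      using vector_field_anchor[OF P one_form_differential[OF h(1)]] differential_cotangent[OF h(1)]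
      by (auto simp: section_of_def leaf_tangent_def)
  qed (simp add: h \<beta>)
qed

text \<open>\<open>metric_at\<close> is evaluated in one chosen chart. The Jacobians in the law of
  \<open>g\<close> are absorbed by the two vectors, so every chart around \<open>p\<close> gives the
  same value.\<close>

lemma metric_at_chart:
  assumes g: "pseudo_riemannian_metric A g"
    and v: "v \<in> tangent_space A p" and w: "w \<in> tangent_space A p" and c: "c \<in> A" "p \<in> cdom c"
  shows "metric_at A g p v w = v c \<bullet> (g p c *v w c)"
proof -
  define d where "d = chart_at A p"
  have d: "d \<in> A" "p \<in> cdom d"
    by (simp_all add: d_def chart_at)
  have "v c = jac d c p *v v d" "w c = jac d c p *v w d"
    using v w c d unfolding tangent_space_def by blast+
  moreover have "g p d = transpose (jac d c p) ** g p c ** jac d c p"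
    using g c d unfolding pseudo_riemannian_metric_def by blast
  \<comment> \<open>The transpose from the law of \<open>g\<close> lands in the right argument,
    while \<open>inner_transpose_mult\<close> handles the left one; hence the commuting.\<close>
  ultimately have "v d \<bullet> (g p d *v w d) = v c \<bullet> (g p c *v w c)"
    by (simp only: matrix_vector_mul_assoc[symmetric] inner_transpose_mult
        inner_commute[of "v d"] inner_commute[of "v c"])
      (simp only: inner_commute)
  then show ?thesis
    by (simp add: metric_at_def d_def)
qed

section \<open>Lowering the index, and Casimir forms\<close>

lemma one_form_flat:
  assumes g: "pseudo_riemannian_metric A g" and X: "vector_field A UNIV X"
  shows "one_form A (\<lambda>q c. g q c *v X q c)"
proof -
  have "(\<lambda>c. g q c *v X q c) \<in> cotangent_space A q" for q
  proof -
    have Xq: "X q \<in> tangent_space A q"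
      using X by (simp add: vector_field_def)
    have "g q c *v X q c = transpose (jac c d q) *v (g q d *v X q d)"
      if "c \<in> A" "d \<in> A" "q \<in> cdom c \<inter> cdom d" for c d
    proof -
      have "X q d = jac c d q *v X q c"
        using Xq that unfolding tangent_space_def by blast
      moreover have "g q c = transpose (jac c d q) ** g q d ** jac c d q"
        using g that unfolding pseudo_riemannian_metric_def by blast
      ultimately show ?thesis
        by (simp only: matrix_vector_mul_assoc[symmetric])
    qed
    moreover have "g q c *v X q c = 0" if "\<not> (c \<in> A \<and> q \<in> cdom c)" for c
    proof -
      have "X q c = 0"
        using Xq that unfolding tangent_space_def by blast
      then show ?thesis by simp
    qed
    ultimately show ?thesis
      unfolding cotangent_space_def mem_Collect_eq by blast
  qed
  moreover have "Ck_on k (\<lambda>x. g (cinv c x) c *v X (cinv c x) c) (cmap c ` cdom c)" if "c \<in> A" for c k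
    using g X that
    by (intro Ck_on_bilinear[OF bounded_bilinear_matrix_vector_mult open_cmap_cdom])
      (auto simp: pseudo_riemannian_metric_def vector_field_def smooth_components_def smooth_on_def)
  ultimately show ?thesis
    by (simp add: one_form_def smooth_components_def smooth_on_def)
qed

text \<open>This presents any global field as the sharp of a form, the shape in which the hypothesis
  on \<open>nabla\<close> applies. At charts not around \<open>q\<close> both sides are
  \<open>0\<close>, whatever \<open>matrix_inv\<close> returns there.\<close>

lemma sharp_flat:
  assumes g: "pseudo_riemannian_metric A g" and X: "vector_field A UNIV X"
  shows "sharp g (\<lambda>q c. g q c *v X q c) = X"
proof (intro ext)
  fix q c
  show "sharp g (\<lambda>q c. g q c *v X q c) q c = X q c"
  proof (cases "c \<in> A \<and> q \<in> cdom c")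
    case True
    then have "invertible (g q c)"
      using g by (simp add: pseudo_riemannian_metric_def)
    then have "matrix_inv (g q c) ** g q c = mat 1"
      unfolding invertible_def matrix_inv_def by (rule someI2_ex) simp
    then show ?thesis
      by (simp add: sharp_def matrix_vector_mul_assoc)
  next
    case False
    then have "X q c = 0"
      using X unfolding vector_field_def tangent_space_def by blast
    then show ?thesis
      by (simp add: sharp_def)
  qed
qed

text \<open>Let \<open>u\<close> be \<open>P\<close> applied to the metric dual of \<open>v\<close>.
  Reading \<open>u\<close> as a covector in the chart \<open>c\<close>, the leaf vector
  \<open>P u\<close> is orthogonal to \<open>v\<close>; skewness of \<open>P\<close> and symmetry of
  \<open>g\<close> turn this into \<open>u \<bullet> u = 0\<close>. The Euclidean product is
  positive definite, whatever the signature of \<open>g\<close>.\<close>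

lemma casimir_flat:
  assumes P: "bivector_field A P" and g: "pseudo_riemannian_metric A g"
    and v: "v \<in> orthogonal_distribution A g (leaf_tangent A P) q"
    and flat: "(\<lambda>c. g q c *v v c) \<in> cotangent_space A q"
  shows "(\<lambda>c. g q c *v v c) \<in> casimir A P q"
proof -
  have vT: "v \<in> tangent_space A q"
    using v by (simp add: orthogonal_distribution_def)
  have "P q c *v (g q c *v v c) = 0" for c
  proof (cases "c \<in> A \<and> q \<in> cdom c")
    case True
    then have c: "c \<in> A" "q \<in> cdom c" by auto
    define u where "u = P q c *v (g q c *v v c)"
    have tP: "transpose (P q c) = - P q c" and tg: "transpose (g q c) = g q c"
      using P g c unfolding bivector_field_def pseudo_riemannian_metric_def by blast+
    \<comment> \<open>\<open>u\<close> consists of vector components; the differential of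
      \<open>h\<close> is a genuine covector at \<open>q\<close> with the same entries in the chart
      \<open>c\<close>.\<close>
    obtain h where h: "smooth_function A h" "differential A h q c = u"
      using exists_differential[OF c] .
    let ?w = "anchor (P q) (differential A h q)"
    have "?w \<in> leaf_tangent A P q"
      using differential_cotangent[OF h(1)] by (simp add: leaf_tangent_def)
    then have "metric_at A g q v ?w = 0"
      using v by (simp add: orthogonal_distribution_def)
    moreover have "?w \<in> tangent_space A q"
      using vector_field_anchor[OF P one_form_differential[OF h(1)]] by (simp add: vector_field_def)
    ultimately have "0 = v c \<bullet> (g q c *v (P q c *v u))"
      using metric_at_chart[OF g vT _ c, of ?w] h(2) by (simp add: anchor_def)
    also have "\<dots> = (transpose (P q c) *v (transpose (g q c) *v v c)) \<bullet> u"
      by (simp only: inner_transpose_mult)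
    \<comment> \<open>The distributive law with the zero matrix as minuend pulls the minus sign of
      \<open>- P q c\<close> out of the product.\<close>
    also have "\<dots> = - (u \<bullet> u)"
      using matrix_vector_mult_diff_rdistrib[of 0 "P q c" "g q c *v v c"]
      unfolding tP tg by (simp add: u_def)
    finally show ?thesis by (simp add: u_def)
  next
    case False
    then have "v c = 0"
      using vT unfolding tangent_space_def by blast
    then show ?thesis by simp
  qed
  with flat show ?thesis
    by (simp add: casimir_def anchor_def)
qed

section \<open>Sections of the orthogonal complement and their covariant derivatives\<close>

lemma orthogonal_distribution_cut_off:
  assumes X: "section_of A U (orthogonal_distribution A g D) X"
  shows "cut_off \<psi> U X q \<in> orthogonal_distribution A g D q"
proof (cases "q \<in> U")
  case True
  then have "X q \<in> orthogonal_distribution A g D q"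
    using X by (simp add: section_of_def)
  with True show ?thesis
    by (simp add: orthogonal_distribution_def cut_off_def[abs_def] tangent_space_scaleR metric_at_def)
next
  case False
  then show ?thesis
    by (simp add: orthogonal_distribution_def cut_off_def[abs_def] tangent_space_0 metric_at_def)
qed

lemma nabla_orthogonal:
  assumes P: "bivector_field A P" and g: "pseudo_riemannian_metric A g"
    and LC: "levi_civita_connection A g nabla"
    and pres: "\<forall>\<alpha> X. one_form A \<alpha> \<longrightarrow> (\<forall>p. \<alpha> p \<in> casimir A P p) \<longrightarrow>
           section_of A UNIV (leaf_tangent A P) X \<longrightarrow>
           section_of A UNIV (leaf_tangent A P) (nabla (sharp g \<alpha>) X)"
    and X: "section_of A UNIV (orthogonal_distribution A g (leaf_tangent A P)) X"
    and Y: "section_of A UNIV (orthogonal_distribution A g (leaf_tangent A P)) Y"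
  shows "nabla X Y p \<in> orthogonal_distribution A g (leaf_tangent A P) p"
proof -
  have vf: "vector_field A UNIV X" "vector_field A UNIV Y"
    and orth: "\<And>q. X q \<in> orthogonal_distribution A g (leaf_tangent A P) q"
      "\<And>q. Y q \<in> orthogonal_distribution A g (leaf_tangent A P) q"
    using X Y by (auto simp: section_of_def)
  have flat: "one_form A (\<lambda>q c. g q c *v X q c)"
    by (rule one_form_flat[OF g vf(1)])
  then have cas: "(\<lambda>c. g q c *v X q c) \<in> casimir A P q" for q
    by (intro casimir_flat[OF P g orth(1)]) (simp add: one_form_def)
  \<comment> \<open>\<open>X\<close> is the sharp of its own dual form, which is Casimir, so
    \<open>pres\<close> speaks about \<open>nabla X\<close>.\<close>
  have nabla_leaf: "section_of A UNIV (leaf_tangent A P) (nabla X Z)"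
    if "section_of A UNIV (leaf_tangent A P) Z" for Z
    using pres[rule_format, OF flat cas that] by (simp only: sharp_flat[OF g vf(1)])
  have "metric_at A g p (nabla X Y p) w = 0" if w: "w \<in> leaf_tangent A P p" for w
  proof -
    \<comment> \<open>As \<open>Z\<close> is tangent to the leaves everywhere, its product with
      \<open>Y\<close> vanishes identically and not only at \<open>p\<close>, so it can be
      differentiated.\<close>
    obtain Z where Z: "section_of A UNIV (leaf_tangent A P) Z" "Z p = w"
      using leaf_tangent_eq_vector_field[OF P w] .
    have vZ: "vector_field A UNIV Z"
      using Z(1) by (simp add: section_of_def)
    have "metric_at A g q (Y q) (Z q) = 0" for q
      using orth(2)[of q] Z(1) by (simp add: section_of_def orthogonal_distribution_def)
    then have "vf_apply A X (\<lambda>q. metric_at A g q (Y q) (Z q)) p = 0"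
      by (simp add: vf_apply_def differential_zero pairing_def)
    moreover have "vf_apply A X (\<lambda>q. metric_at A g q (Y q) (Z q)) p =
        metric_at A g p (nabla X Y p) (Z p) + metric_at A g p (Y p) (nabla X Z p)"
      using LC vf vZ unfolding levi_civita_connection_def by blast
    moreover have "metric_at A g p (Y p) (nabla X Z p) = 0"
      using orth(2)[of p] nabla_leaf[OF Z(1)] by (simp add: section_of_def orthogonal_distribution_def)
    ultimately show ?thesis
      using Z(2) by simp
  qed
  moreover have "vector_field A UNIV (nabla X Y)"
    using LC[unfolded levi_civita_connection_def affine_connection_def, THEN conjunct1, THEN conjunct1] vf
    by blast
  ultimately show ?thesis
    by (simp add: orthogonal_distribution_def vector_field_def)
qed

end

theorem corollary2:
  fixes A :: "('m::{t2_space, second_countable_topology}, 'n::finite) chart set"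
    and P g :: "'m \<Rightarrow> ('m, 'n) chart \<Rightarrow> real ^ 'n ^ 'n"
    and k :: nat
    and nabla :: "('m \<Rightarrow> ('m, 'n) chart \<Rightarrow> real ^ 'n) \<Rightarrow> ('m \<Rightarrow> ('m, 'n) chart \<Rightarrow> real ^ 'n) \<Rightarrow>
      'm \<Rightarrow> ('m, 'n) chart \<Rightarrow> real ^ 'n"
  assumes "regular_poisson_manifold A P k"
    and "pseudo_riemannian_metric A g"
    and "nondegenerate_on A g (leaf_tangent A P)"
    and "levi_civita_connection A g nabla"
    and "\<forall>\<alpha> X. one_form A \<alpha> \<longrightarrow> (\<forall>p. \<alpha> p \<in> casimir A P p) \<longrightarrow>
           section_of A UNIV (leaf_tangent A P) X \<longrightarrow>
           section_of A UNIV (leaf_tangent A P) (nabla (sharp g \<alpha>) X)"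
  shows "integrable_distribution A (orthogonal_distribution A g (leaf_tangent A P))"
proof -
  let ?N = "orthogonal_distribution A g (leaf_tangent A P)"
  have atlas: "smooth_atlas A" and P: "bivector_field A P"
    using assms(1) by (auto simp: regular_poisson_manifold_def poisson_bivector_def)
  have "lie_bracket A X Y p \<in> ?N p"
    if U: "open U" "p \<in> U" and X: "section_of A U ?N X" and Y: "section_of A U ?N Y" for U X Y p
  proof -
    have vf: "vector_field A U X" "vector_field A U Y"
      using X Y by (auto simp: section_of_def)
    obtain \<psi> K where \<psi>: "smooth_function A \<psi>" "\<psi> p = 1" "differential A \<psi> p = (\<lambda>c. 0)"
      and K: "closed K" "K \<subseteq> U" "\<And>q. q \<notin> K \<Longrightarrow> \<psi> q = 0"
      using bump_function[OF atlas U] by blast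
    let ?X = "cut_off \<psi> U X" and ?Y = "cut_off \<psi> U Y"
    have sec: "section_of A UNIV ?N ?X" "section_of A UNIV ?N ?Y"
      using vector_field_cut_off[OF atlas U(1) _ \<psi>(1) K] vf
        orthogonal_distribution_cut_off[OF atlas X] orthogonal_distribution_cut_off[OF atlas Y]
      by (auto simp: section_of_def)
    note nabla = nabla_orthogonal[OF atlas P assms(2,4,5)]
    \<comment> \<open>This is the vanishing of torsion, available for the cut-off fields because
      they are global.\<close>
    have "lie_bracket A ?X ?Y p c = nabla ?X ?Y p c - nabla ?Y ?X p c" for c
      using assms(4)[unfolded levi_civita_connection_def, THEN conjunct2, THEN conjunct1] sec
      unfolding section_of_def by metis
    then have "lie_bracket A X Y p = (\<lambda>c. nabla ?X ?Y p c - nabla ?Y ?X p c)"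
      using lie_bracket_cut_off[OF atlas U vf \<psi>] by (metis ext)
    \<comment> \<open>Both fields are sections of the complement, so \<open>nabla_orthogonal\<close>
      applies in either order, and the fibre is closed under differences.\<close>
    moreover have "(\<lambda>c. nabla ?X ?Y p c - nabla ?Y ?X p c) \<in> ?N p"
      using nabla[OF sec] nabla[OF sec(2,1)] tangent_space_diff[OF atlas]
      by (simp add: orthogonal_distribution_def metric_at_def inner_diff_left)
    ultimately show ?thesis by simp
  qed
  then show ?thesis
    unfolding integrable_distribution_def by blast
qed

end
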